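(* Let $A$ be a pre-Prüfer ring. Then $\mathrm{Spec}(A_{\mathfrak m})$ has the regular total order property for every maximal ideal $\mathfrak m$ of $A$.
   Context: All rings are commutative with identity. An ideal is regular if it contains a non-zero-divisor. A ring is a Prüfer ring if every finitely generated regular ideal is invertible (in its total ring of fractions). A ring $A$ is a pre-Prüfer ring if every proper homomorphic image of $A$ is a Prüfer ring, i.e. $A/\mathfrak a$ is a Prüfer ring for every ideal $\mathfrak a$ of $A$ with $\mathfrak a\neq 0$ and $\mathfrak a\neq A$. A family $\mathcal I$ of ideals of a ring $R$ has the regular total order property if for every pair $I,J\in\mathcal I$ at least one of which is a regular ideal of $R$, the ideals $I$ and $J$ are comparable under inclusion. *)

theory Defs
  imports "HOL-Algebra.QuotRing" "HOL-Algebra.Ideal_Product"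
begin

text \<open>Commutative rings with identity are \<^locale>\<open>cring\<close>s, the zero ring included.\<close>

section \<open>Rings of fractions\<close>

text \<open>
  The fraction \<open>a/s\<close> is the class of \<open>(a, s)\<close> under the relation
  \<open>(a, s) ~ (b, t) \<longleftrightarrow> (\<exists>u\<in>S. u (a t - b s) = 0)\<close>; the condition is written without
  subtraction. The factor \<open>u\<close> is needed because \<open>S\<close> may contain zero divisors.
\<close>

definition frac_of :: "('a, 'b) ring_scheme \<Rightarrow> 'a set \<Rightarrow> 'a \<Rightarrow> 'a \<Rightarrow> ('a \<times> 'a) set" where
  "frac_of R S a s = {(b, t) \<in> carrier R \<times> S.
     \<exists>u\<in>S. u \<otimes>\<^bsub>R\<^esub> (a \<otimes>\<^bsub>R\<^esub> t) = u \<otimes>\<^bsub>R\<^esub> (b \<otimes>\<^bsub>R\<^esub> s)}"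

text \<open>
  The unions below range over all representatives. They all give the same class, as
  \<open>localization_mult\<close> and \<open>localization_add\<close> show, so each union is that class.
\<close>

definition localization :: "('a, 'b) ring_scheme \<Rightarrow> 'a set \<Rightarrow> ('a \<times> 'a) set ring" where
  "localization R S =
    \<lparr>carrier = {frac_of R S a s | a s. a \<in> carrier R \<and> s \<in> S},
     mult = (\<lambda>X Y. \<Union>(a, s)\<in>X. \<Union>(b, t)\<in>Y. frac_of R S (a \<otimes>\<^bsub>R\<^esub> b) (s \<otimes>\<^bsub>R\<^esub> t)),
     one = frac_of R S \<one>\<^bsub>R\<^esub> \<one>\<^bsub>R\<^esub>,
     zero = frac_of R S \<zero>\<^bsub>R\<^esub> \<one>\<^bsub>R\<^esub>,
     add = (\<lambda>X Y. \<Union>(a, s)\<in>X. \<Union>(b, t)\<in>Y.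
       frac_of R S (a \<otimes>\<^bsub>R\<^esub> t \<oplus>\<^bsub>R\<^esub> b \<otimes>\<^bsub>R\<^esub> s) (s \<otimes>\<^bsub>R\<^esub> t))\<rparr>"

definition loc_map :: "('a, 'b) ring_scheme \<Rightarrow> 'a set \<Rightarrow> 'a \<Rightarrow> ('a \<times> 'a) set" where
  "loc_map R S a = frac_of R S a \<one>\<^bsub>R\<^esub>"

definition localization_at :: "('a, 'b) ring_scheme \<Rightarrow> 'a set \<Rightarrow> ('a \<times> 'a) set ring" where
  "localization_at R P = localization R (carrier R - P)"

definition regular_elements :: "('a, 'b) ring_scheme \<Rightarrow> 'a set" where
  "regular_elements R =
     {a \<in> carrier R. \<forall>b\<in>carrier R. a \<otimes>\<^bsub>R\<^esub> b = \<zero>\<^bsub>R\<^esub> \<longrightarrow> b = \<zero>\<^bsub>R\<^esub>}"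

definition total_fraction_ring :: "('a, 'b) ring_scheme \<Rightarrow> ('a \<times> 'a) set ring" where
  "total_fraction_ring R = localization R (regular_elements R)"

definition to_total :: "('a, 'b) ring_scheme \<Rightarrow> 'a \<Rightarrow> ('a \<times> 'a) set" where
  "to_total R = loc_map R (regular_elements R)"

subsection \<open>The construction yields commutative rings\<close>

lemma UN_pairs_const:
  fixes K :: "'k set"
  assumes "(a, b) \<in> X" "(c, d) \<in> Y"
    and "\<And>x y z w. (x, y) \<in> X \<Longrightarrow> (z, w) \<in> Y \<Longrightarrow> F x y z w = K"
  shows "(\<Union>(x, y)\<in>X. \<Union>(z, w)\<in>Y. F x y z w) = K"
proof (intro Set.set_eqI iffI)
  fix v assume "v \<in> K"
  hence "v \<in> F a b c d" using assms by simp
  thus "v \<in> (\<Union>(x, y)\<in>X. \<Union>(z, w)\<in>Y. F x y z w)"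
    using assms(1,2) by fast
qed (use assms(3) in fast)

locale mult_subset = cring R + submonoid S R for R (structure) and S
begin

lemma S_carr [simp]: "s \<in> S \<Longrightarrow> s \<in> carrier R"
  using subset by blast

lemma frac_of_self: "a \<in> carrier R \<Longrightarrow> s \<in> S \<Longrightarrow> (a, s) \<in> frac_of R S a s"
  unfolding frac_of_def using one_closed by auto

lemma frac_of_eqI:
  assumes c: "a \<in> carrier R" "b \<in> carrier R" "s \<in> S" "t \<in> S" "u \<in> S"
    and e: "u \<otimes> (a \<otimes> t) = u \<otimes> (b \<otimes> s)"
  shows "frac_of R S a s = frac_of R S b t"
proof -
  have *: "frac_of R S a s \<subseteq> frac_of R S b t"
    if c: "a \<in> carrier R" "b \<in> carrier R" "s \<in> S" "t \<in> S" "u \<in> S"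
      and e: "u \<otimes> (a \<otimes> t) = u \<otimes> (b \<otimes> s)" for a b s t
  proof clarify
    fix x y assume "(x, y) \<in> frac_of R S a s"
    then obtain v where v: "x \<in> carrier R" "y \<in> S" "v \<in> S" "v \<otimes> (a \<otimes> y) = v \<otimes> (x \<otimes> s)"
      by (auto simp: frac_of_def)
    have "(u \<otimes> v \<otimes> s) \<otimes> (b \<otimes> y) = (v \<otimes> y) \<otimes> (u \<otimes> (b \<otimes> s))"
      using c v(1-3) by (simp add: m_ac)
    also have "\<dots> = (u \<otimes> t) \<otimes> (v \<otimes> (a \<otimes> y))"
      using c v(1-3) by (simp add: e[symmetric] m_ac)
    also have "\<dots> = (u \<otimes> v \<otimes> s) \<otimes> (x \<otimes> t)"
      using c v(1-3) by (simp add: v(4) m_ac)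
    finally show "(x, y) \<in> frac_of R S b t"
      unfolding frac_of_def using c v by (auto intro!: bexI[of _ "u \<otimes> v \<otimes> s"])
  qed
  show ?thesis using *[OF c e] *[OF c(2,1,4,3,5) e[symmetric]] by blast
qed

lemma frac_of_eq_iff:
  assumes "a \<in> carrier R" "b \<in> carrier R" "s \<in> S" "t \<in> S"
  shows "frac_of R S a s = frac_of R S b t \<longleftrightarrow> (\<exists>u\<in>S. u \<otimes> (a \<otimes> t) = u \<otimes> (b \<otimes> s))"
proof
  assume "frac_of R S a s = frac_of R S b t"
  hence "(b, t) \<in> frac_of R S a s" using frac_of_self assms by blast
  thus "\<exists>u\<in>S. u \<otimes> (a \<otimes> t) = u \<otimes> (b \<otimes> s)" by (auto simp: frac_of_def)
qed (use frac_of_eqI assms in blast)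

lemma localization_mult:
  assumes c: "a \<in> carrier R" "b \<in> carrier R" "s \<in> S" "t \<in> S"
  shows "frac_of R S a s \<otimes>\<^bsub>localization R S\<^esub> frac_of R S b t = frac_of R S (a \<otimes> b) (s \<otimes> t)"
proof -
  have "frac_of R S (x \<otimes> z) (y \<otimes> w) = frac_of R S (a \<otimes> b) (s \<otimes> t)"
    if xy: "(x, y) \<in> frac_of R S a s" and zw: "(z, w) \<in> frac_of R S b t" for x y z w
  proof -
    obtain u where u: "x \<in> carrier R" "y \<in> S" "u \<in> S" and eu: "u \<otimes> (a \<otimes> y) = u \<otimes> (x \<otimes> s)"
      using xy by (auto simp: frac_of_def)
    obtain v where v: "z \<in> carrier R" "w \<in> S" "v \<in> S" and ev: "v \<otimes> (b \<otimes> w) = v \<otimes> (z \<otimes> t)"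
      using zw by (auto simp: frac_of_def)
    have "(u \<otimes> v) \<otimes> ((a \<otimes> b) \<otimes> (y \<otimes> w)) = (u \<otimes> (a \<otimes> y)) \<otimes> (v \<otimes> (b \<otimes> w))"
      using c u v by (simp add: m_ac)
    also have "\<dots> = (u \<otimes> v) \<otimes> ((x \<otimes> z) \<otimes> (s \<otimes> t))"
      unfolding eu ev using c u v by (simp add: m_ac)
    finally show ?thesis
      using c u v by (intro frac_of_eqI[of _ _ _ _ "u \<otimes> v"]) auto
  qed
  note eq = this
  have "(a, s) \<in> frac_of R S a s" "(b, t) \<in> frac_of R S b t"
    using frac_of_self c by auto
  from UN_pairs_const[OF this eq] show ?thesis
    unfolding localization_def by simp
qed

lemma localization_add:
  assumes c: "a \<in> carrier R" "b \<in> carrier R" "s \<in> S" "t \<in> S"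
  shows "frac_of R S a s \<oplus>\<^bsub>localization R S\<^esub> frac_of R S b t
    = frac_of R S (a \<otimes> t \<oplus> b \<otimes> s) (s \<otimes> t)"
proof -
  have "frac_of R S (x \<otimes> w \<oplus> z \<otimes> y) (y \<otimes> w) = frac_of R S (a \<otimes> t \<oplus> b \<otimes> s) (s \<otimes> t)"
    if xy: "(x, y) \<in> frac_of R S a s" and zw: "(z, w) \<in> frac_of R S b t" for x y z w
  proof -
    obtain u where u: "x \<in> carrier R" "y \<in> S" "u \<in> S" and eu: "u \<otimes> (a \<otimes> y) = u \<otimes> (x \<otimes> s)"
      using xy by (auto simp: frac_of_def)
    obtain v where v: "z \<in> carrier R" "w \<in> S" "v \<in> S" and ev: "v \<otimes> (b \<otimes> w) = v \<otimes> (z \<otimes> t)"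
      using zw by (auto simp: frac_of_def)
    have "(u \<otimes> v) \<otimes> ((a \<otimes> t \<oplus> b \<otimes> s) \<otimes> (y \<otimes> w))
      = (v \<otimes> w \<otimes> t) \<otimes> (u \<otimes> (a \<otimes> y)) \<oplus> (u \<otimes> y \<otimes> s) \<otimes> (v \<otimes> (b \<otimes> w))"
      using c u v by (simp add: m_ac l_distr r_distr)
    also have "\<dots> = (u \<otimes> v) \<otimes> ((x \<otimes> w \<oplus> z \<otimes> y) \<otimes> (s \<otimes> t))"
      unfolding eu ev using c u v by (simp add: m_ac l_distr r_distr)
    finally show ?thesis
      using c u v by (intro frac_of_eqI[of _ _ _ _ "u \<otimes> v"]) auto
  qed
  note eq = this
  have "(a, s) \<in> frac_of R S a s" "(b, t) \<in> frac_of R S b t"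
    using frac_of_self c by auto
  from UN_pairs_const[OF this eq] show ?thesis
    unfolding localization_def by simp
qed

lemma localization_one: "\<one>\<^bsub>localization R S\<^esub> = frac_of R S \<one> \<one>"
  by (simp add: localization_def)

lemma localization_zero: "\<zero>\<^bsub>localization R S\<^esub> = frac_of R S \<zero> \<one>"
  by (simp add: localization_def)

lemma frac_of_closed:
  "a \<in> carrier R \<Longrightarrow> s \<in> S \<Longrightarrow> frac_of R S a s \<in> carrier (localization R S)"
  unfolding localization_def by auto

lemma localization_cases:
  assumes "X \<in> carrier (localization R S)"
  obtains a s where "a \<in> carrier R" "s \<in> S" "X = frac_of R S a s"
  using assms unfolding localization_def by auto

lemma frac_of_eqI':
  "\<lbrakk>a \<in> carrier R; b \<in> carrier R; s \<in> S; t \<in> S; a \<otimes> t = b \<otimes> s\<rbrakk>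
    \<Longrightarrow> frac_of R S a s = frac_of R S b t"
  by (rule frac_of_eqI[of _ _ _ _ \<one>]) auto

lemma localization_cring: "cring (localization R S)"
proof (rule cringI)
  note ops = localization_mult localization_add localization_one localization_zero frac_of_closed
  let ?L = "localization R S"
  show "abelian_group ?L"
  proof (rule abelian_groupI)
    fix X assume "X \<in> carrier ?L"
    then obtain a s where X: "a \<in> carrier R" "s \<in> S" "X = frac_of R S a s"
      by (rule localization_cases)
    show "\<zero>\<^bsub>?L\<^esub> \<oplus>\<^bsub>?L\<^esub> X = X" using X by (simp add: ops)
    have "(\<ominus> a \<otimes> s) \<oplus> (a \<otimes> s) = \<zero>" using X by (simp add: l_minus l_neg)
    hence "frac_of R S (\<ominus> a) s \<oplus>\<^bsub>?L\<^esub> X = \<zero>\<^bsub>?L\<^esub>"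
      using X by (simp add: ops) (rule frac_of_eqI', auto)
    thus "\<exists>Y\<in>carrier ?L. Y \<oplus>\<^bsub>?L\<^esub> X = \<zero>\<^bsub>?L\<^esub>"
      using X frac_of_closed by blast
  next
    fix X Y assume "X \<in> carrier ?L" "Y \<in> carrier ?L"
    then obtain a s b t where X: "a \<in> carrier R" "s \<in> S" "X = frac_of R S a s"
      and Y: "b \<in> carrier R" "t \<in> S" "Y = frac_of R S b t"
      by (metis localization_cases)
    show "X \<oplus>\<^bsub>?L\<^esub> Y \<in> carrier ?L" using X Y by (simp add: ops)
    show "X \<oplus>\<^bsub>?L\<^esub> Y = Y \<oplus>\<^bsub>?L\<^esub> X" using X Y by (simp add: ops a_comm m_comm)
  next
    fix X Y Z assume "X \<in> carrier ?L" "Y \<in> carrier ?L" "Z \<in> carrier ?L"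
    then obtain a s b t c r where "a \<in> carrier R" "s \<in> S" "X = frac_of R S a s"
      "b \<in> carrier R" "t \<in> S" "Y = frac_of R S b t"
      "c \<in> carrier R" "r \<in> S" "Z = frac_of R S c r"
      by (metis localization_cases)
    thus "X \<oplus>\<^bsub>?L\<^esub> Y \<oplus>\<^bsub>?L\<^esub> Z = X \<oplus>\<^bsub>?L\<^esub> (Y \<oplus>\<^bsub>?L\<^esub> Z)"
      by (simp add: ops l_distr r_distr a_assoc m_ac)
  qed (simp add: ops)
  show "Group.comm_monoid ?L"
  proof (rule comm_monoidI)
    fix X assume "X \<in> carrier ?L"
    then obtain a s where X: "a \<in> carrier R" "s \<in> S" "X = frac_of R S a s"
      by (rule localization_cases)
    show "\<one>\<^bsub>?L\<^esub> \<otimes>\<^bsub>?L\<^esub> X = X" using X by (simp add: ops)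
  next
    fix X Y assume "X \<in> carrier ?L" "Y \<in> carrier ?L"
    then obtain a s b t where X: "a \<in> carrier R" "s \<in> S" "X = frac_of R S a s"
      and Y: "b \<in> carrier R" "t \<in> S" "Y = frac_of R S b t"
      by (metis localization_cases)
    show "X \<otimes>\<^bsub>?L\<^esub> Y \<in> carrier ?L" using X Y by (simp add: ops)
    show "X \<otimes>\<^bsub>?L\<^esub> Y = Y \<otimes>\<^bsub>?L\<^esub> X" using X Y by (simp add: ops m_comm)
  next
    fix X Y Z assume "X \<in> carrier ?L" "Y \<in> carrier ?L" "Z \<in> carrier ?L"
    then obtain a s b t c r where "a \<in> carrier R" "s \<in> S" "X = frac_of R S a s"
      "b \<in> carrier R" "t \<in> S" "Y = frac_of R S b t"
      "c \<in> carrier R" "r \<in> S" "Z = frac_of R S c r"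
      by (metis localization_cases)
    thus "X \<otimes>\<^bsub>?L\<^esub> Y \<otimes>\<^bsub>?L\<^esub> Z = X \<otimes>\<^bsub>?L\<^esub> (Y \<otimes>\<^bsub>?L\<^esub> Z)"
      by (simp add: ops m_assoc)
  qed (simp add: ops)
  fix X Y Z assume "X \<in> carrier ?L" "Y \<in> carrier ?L" "Z \<in> carrier ?L"
  then obtain a s b t c r where *: "a \<in> carrier R" "s \<in> S" "X = frac_of R S a s"
    "b \<in> carrier R" "t \<in> S" "Y = frac_of R S b t"
    "c \<in> carrier R" "r \<in> S" "Z = frac_of R S c r"
    by (metis localization_cases)
  show "(X \<oplus>\<^bsub>?L\<^esub> Y) \<otimes>\<^bsub>?L\<^esub> Z = X \<otimes>\<^bsub>?L\<^esub> Z \<oplus>\<^bsub>?L\<^esub> Y \<otimes>\<^bsub>?L\<^esub> Z"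
    using * by (simp add: ops) (rule frac_of_eqI', auto simp: l_distr r_distr m_ac)
qed

lemma loc_map_hom: "loc_map R S \<in> ring_hom R (localization R S)"
  by (rule ring_hom_memI)
    (simp_all add: loc_map_def localization_mult localization_add localization_one frac_of_closed)

end

lemma (in cring) mult_subset_regular_elements: "mult_subset R (regular_elements R)"
proof (intro mult_subset.intro)
  show "submonoid (regular_elements R) R"
  proof
    fix x y assume "x \<in> regular_elements R" "y \<in> regular_elements R"
    hence c: "x \<in> carrier R" "y \<in> carrier R"
      and x: "\<And>b. b \<in> carrier R \<Longrightarrow> x \<otimes> b = \<zero> \<Longrightarrow> b = \<zero>"
      and y: "\<And>b. b \<in> carrier R \<Longrightarrow> y \<otimes> b = \<zero> \<Longrightarrow> b = \<zero>"
      unfolding regular_elements_def by blast+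
    have "b = \<zero>" if b: "b \<in> carrier R" "x \<otimes> y \<otimes> b = \<zero>" for b
      by (rule y[OF b(1)], rule x) (use b c m_assoc[of x y b] in simp_all)
    thus "x \<otimes> y \<in> regular_elements R"
      using c m_closed[of x y] unfolding regular_elements_def by blast
  qed (auto simp: regular_elements_def)
qed (rule cring_axioms)

lemma (in primeideal) mult_subset_compl: "mult_subset R (carrier R - I)"
proof (intro mult_subset.intro)
  show "submonoid (carrier R - I) R"
    using I_prime one_imp_carrier I_notcarr by unfold_locales auto
qed (rule cring_axioms)


section \<open>Pruefer and pre-Pruefer rings\<close>

definition regular_ideal :: "('a, 'b) ring_scheme \<Rightarrow> 'a set \<Rightarrow> bool" where
  "regular_ideal R I \<longleftrightarrow> ideal I R \<and> I \<inter> regular_elements R \<noteq> {}"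

definition fin_gen_ideal :: "('a, 'b) ring_scheme \<Rightarrow> 'a set \<Rightarrow> bool" where
  "fin_gen_ideal R I \<longleftrightarrow> (\<exists>X \<subseteq> carrier R. finite X \<and> I = Idl\<^bsub>R\<^esub> X)"

definition total_submodule :: "('a, 'b) ring_scheme \<Rightarrow> ('a \<times> 'a) set set \<Rightarrow> bool" where
  "total_submodule R J \<longleftrightarrow> additive_subgroup J (total_fraction_ring R) \<and>
     (\<forall>r\<in>carrier R. \<forall>x\<in>J. to_total R r \<otimes>\<^bsub>total_fraction_ring R\<^esub> x \<in> J)"

text \<open>
  \<open>I\<close> is invertible if \<open>I J = R\<close> for some \<open>R\<close>-submodule \<open>J\<close> of the total ring of fractions,
  where \<open>I\<close> and \<open>R\<close> are identified with their images. The constant \<^const>\<open>ideal_prod\<close> makes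
  sense for arbitrary subsets: it is the set of finite nonempty sums of products. Such a \<open>J\<close> is
  automatically a fractional ideal: clearing denominators in an equation
  \<open>1 = \<Sum>a\<^sub>i b\<^sub>i\<close> yields a regular \<open>d \<in> I\<close>, and \<open>d J \<subseteq> R\<close>.
\<close>

definition invertible_ideal :: "('a, 'b) ring_scheme \<Rightarrow> 'a set \<Rightarrow> bool" where
  "invertible_ideal R I \<longleftrightarrow> ideal I R \<and>
     (\<exists>J. total_submodule R J \<and>
          ideal_prod (total_fraction_ring R) (to_total R ` I) J = to_total R ` carrier R)"

locale pruefer_ring = cring +
  assumes fin_gen_regular_invertible:
    "\<lbrakk>ideal I R; fin_gen_ideal R I; regular_ideal R I\<rbrakk> \<Longrightarrow> invertible_ideal R I"

locale pre_pruefer_ring = cring +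
  assumes proper_quotient_pruefer:
    "\<lbrakk>ideal I R; I \<noteq> {\<zero>}; I \<noteq> carrier R\<rbrakk> \<Longrightarrow> pruefer_ring (R Quot I)"


section \<open>Spectra and the regular total order property\<close>

definition Spec :: "('a, 'b) ring_scheme \<Rightarrow> 'a set set" where
  "Spec R = {P. primeideal P R}"

definition regular_total_order_property :: "('a, 'b) ring_scheme \<Rightarrow> 'a set set \<Rightarrow> bool" where
  "regular_total_order_property R F \<longleftrightarrow>
     (\<forall>I\<in>F. \<forall>J\<in>F. regular_ideal R I \<or> regular_ideal R J \<longrightarrow> I \<subseteq> J \<or> J \<subseteq> I)"

end

theory Submission
  imports Defs
begin

text \<open>
  Let \<open>P\<close> and \<open>Q\<close> be primes of \<open>A\<^sub>M\<close>, with \<open>P\<close> regular, and let \<open>p, q \<subseteq> M\<close> be their contractions to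
  \<open>A\<close>. If \<open>Q = 0\<close>, then \<open>Q \<subseteq> P\<close>. Otherwise a regular element of \<open>P\<close> times a nonzero element of \<open>Q\<close> is
  nonzero, so \<open>p \<inter> q \<noteq> 0\<close> (\<open>contractions_inter_nonzero\<close>), and \<open>B = A/(p \<inter> q)\<close> is a Pruefer ring.

  Suppose that \<open>a \<in> p - q\<close> and \<open>b \<in> q - p\<close>. The image of \<open>a + b\<close> is regular in \<open>B\<close>
  (\<open>regular_modulo_inter_primes\<close>), so the ideal \<open>(a, b)\<close> of \<open>B\<close> is invertible, hence principal
  after localization at \<open>M/(p \<inter> q)\<close> (\<open>invertible_pair_locally_principal\<close>). One of the
  generators then divides the other modulo \<open>p \<inter> q\<close>, locally at \<open>M\<close>. This puts \<open>b\<close> into \<open>p\<close> or \<open>a\<close>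
  into \<open>q\<close>, a contradiction (\<open>primes_comparable_if_inter_nonzero\<close>). An ideal of \<open>A\<^sub>M\<close> is determined by
  its contraction, so the comparability of \<open>p\<close> and \<open>q\<close> gives that of \<open>P\<close> and \<open>Q\<close>.
\<close>

section \<open>Invertible ideals with two generators\<close>

lemma (in cring) inj_on_to_total: "inj_on (to_total R) (carrier R)"
proof (rule inj_onI)
  interpret S: mult_subset R "regular_elements R"
    by (rule mult_subset_regular_elements)
  fix x y assume xy: "x \<in> carrier R" "y \<in> carrier R" and eq: "to_total R x = to_total R y"
  from eq obtain u where u: "u \<in> regular_elements R" "u \<otimes> x = u \<otimes> y"
    unfolding to_total_def loc_map_def
    using xy S.frac_of_eq_iff[of x y \<one> \<one>] by auto
  have uc: "u \<in> carrier R" using u(1) by simp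
  have "u \<otimes> (x \<ominus> y) = u \<otimes> x \<ominus> u \<otimes> y" using uc xy by algebra
  also have "\<dots> = \<zero>" unfolding u(2) using uc xy by algebra
  finally have "x \<ominus> y = \<zero>" using u(1) xy unfolding regular_elements_def by simp
  hence "(x \<ominus> y) \<oplus> y = y" using xy by simp
  moreover have "(x \<ominus> y) \<oplus> y = x" using xy by algebra
  ultimately show "x = y" by simp
qed

lemma (in cring) genideal_pair_cases:
  assumes "a \<in> carrier R" "b \<in> carrier R" "x \<in> Idl {a, b}"
  obtains r s where "r \<in> carrier R" "s \<in> carrier R" "x = r \<otimes> a \<oplus> s \<otimes> b"
proof -
  have "ideal (PIdl a <+> PIdl b) R"
    using assms by (intro add_ideals cgenideal_ideal)
  moreover have "{a, b} \<subseteq> PIdl a <+> PIdl b"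
  proof -
    have "a = \<one> \<otimes> a \<oplus> \<zero> \<otimes> b" "b = \<zero> \<otimes> a \<oplus> \<one> \<otimes> b"
      using assms by simp_all
    thus ?thesis
      unfolding set_add_def' cgenideal_def by blast
  qed
  ultimately have "x \<in> PIdl a <+> PIdl b"
    using genideal_minimal assms(3) by blast
  thus ?thesis
    unfolding set_add_def' cgenideal_def using that by blast
qed

text \<open>
  Write \<open>1 = a u + b v\<close> with \<open>u, v\<close> in the inverse of \<open>(a, b)\<close>. All four products of a generator
  with \<open>u\<close> or \<open>v\<close> lie in \<open>R\<close>; put \<open>e = a u\<close>, \<open>f = b u\<close>, \<open>g = a v\<close>, so that \<open>b v = 1 - e\<close>. The
  equations are then \<open>a (b u) = b (a u)\<close> and \<open>b (a v) = a (b v)\<close>. They express that \<open>(a, b)\<close> is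
  locally principal: \<open>a\<close> divides \<open>b\<close> wherever \<open>e\<close> is a unit, and \<open>b\<close> divides \<open>a\<close> wherever
  \<open>1 - e\<close> is one.
\<close>

lemma (in cring) invertible_pair_locally_principal:
  assumes a: "a \<in> carrier R" and b: "b \<in> carrier R"
    and inv: "invertible_ideal R (Idl {a, b})"
  obtains e f g where "e \<in> carrier R" "f \<in> carrier R" "g \<in> carrier R"
    "a \<otimes> f = b \<otimes> e" "b \<otimes> g = a \<otimes> (\<one> \<ominus> e)"
proof -
  interpret S: mult_subset R "regular_elements R"
    by (rule mult_subset_regular_elements)
  define T where "T = total_fraction_ring R"
  define \<phi> where "\<phi> = to_total R"
  interpret T: cring T
    unfolding T_def total_fraction_ring_def by (rule S.localization_cring)
  have hom: "\<phi> \<in> ring_hom R T"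
    unfolding \<phi>_def T_def to_total_def total_fraction_ring_def by (rule S.loc_map_hom)
  note hc = ring_hom_closed[OF hom] and hm = ring_hom_mult[OF hom]
    and ha = ring_hom_add[OF hom] and h1 = ring_hom_one[OF hom]
  obtain J where J: "additive_subgroup J T"
    and JR: "\<And>r x. r \<in> carrier R \<Longrightarrow> x \<in> J \<Longrightarrow> \<phi> r \<otimes>\<^bsub>T\<^esub> x \<in> J"
    and prod: "ideal_prod T (\<phi> ` (Idl {a, b})) J = \<phi> ` carrier R"
    using inv unfolding invertible_ideal_def total_submodule_def T_def \<phi>_def by blast
  interpret J: additive_subgroup J T by (rule J)
  have Jc: "x \<in> carrier T" if "x \<in> J" for x using that J.a_subset by blast
  \<comment> \<open>Since \<open>J\<close> is a submodule, a sum of products of \<open>(a, b)\<close> with \<open>J\<close> collapses to two terms.\<close>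
  have "\<exists>u\<in>J. \<exists>v\<in>J. z = \<phi> a \<otimes>\<^bsub>T\<^esub> u \<oplus>\<^bsub>T\<^esub> \<phi> b \<otimes>\<^bsub>T\<^esub> v"
    if "z \<in> ideal_prod T (\<phi> ` (Idl {a, b})) J" for z
    using that
  proof induction
    case (prod i j)
    then obtain x where x: "x \<in> Idl {a, b}" "i = \<phi> x" by blast
    obtain r s where rs: "r \<in> carrier R" "s \<in> carrier R" "x = r \<otimes> a \<oplus> s \<otimes> b"
      using genideal_pair_cases[OF a b x(1)] by blast
    have "i \<otimes>\<^bsub>T\<^esub> j = \<phi> a \<otimes>\<^bsub>T\<^esub> (\<phi> r \<otimes>\<^bsub>T\<^esub> j) \<oplus>\<^bsub>T\<^esub> \<phi> b \<otimes>\<^bsub>T\<^esub> (\<phi> s \<otimes>\<^bsub>T\<^esub> j)"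
      using rs a b Jc[OF prod(2)]
      by (simp add: x(2) hc hm ha T.r_distr T.m_ac)
    thus ?case using JR rs prod(2) by blast
  next
    case (sum z w)
    then obtain u v u' v' where *: "u \<in> J" "v \<in> J" "u' \<in> J" "v' \<in> J"
      "z = \<phi> a \<otimes>\<^bsub>T\<^esub> u \<oplus>\<^bsub>T\<^esub> \<phi> b \<otimes>\<^bsub>T\<^esub> v" "w = \<phi> a \<otimes>\<^bsub>T\<^esub> u' \<oplus>\<^bsub>T\<^esub> \<phi> b \<otimes>\<^bsub>T\<^esub> v'"
      by blast
    have "z \<oplus>\<^bsub>T\<^esub> w = \<phi> a \<otimes>\<^bsub>T\<^esub> (u \<oplus>\<^bsub>T\<^esub> u') \<oplus>\<^bsub>T\<^esub> \<phi> b \<otimes>\<^bsub>T\<^esub> (v \<oplus>\<^bsub>T\<^esub> v')"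
      using * a b by (simp add: Jc hc T.r_distr T.a_ac)
    thus ?case using * J.a_closed by blast
  qed
  moreover have "\<phi> \<one> \<in> ideal_prod T (\<phi> ` (Idl {a, b})) J"
    unfolding prod by simp
  ultimately obtain u v where uv: "u \<in> J" "v \<in> J"
    "\<phi> \<one> = \<phi> a \<otimes>\<^bsub>T\<^esub> u \<oplus>\<^bsub>T\<^esub> \<phi> b \<otimes>\<^bsub>T\<^esub> v"
    by blast
  have mem: "\<phi> x \<otimes>\<^bsub>T\<^esub> j \<in> \<phi> ` carrier R" if "x \<in> {a, b}" "j \<in> J" for x j
    using that genideal_self[of "{a, b}"] a b
    unfolding prod[symmetric] by (intro ideal_prod.prod) auto
  obtain e f g h where efgh: "e \<in> carrier R" "f \<in> carrier R" "g \<in> carrier R" "h \<in> carrier R"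
    and e: "\<phi> a \<otimes>\<^bsub>T\<^esub> u = \<phi> e" and f: "\<phi> b \<otimes>\<^bsub>T\<^esub> u = \<phi> f"
    and g: "\<phi> a \<otimes>\<^bsub>T\<^esub> v = \<phi> g" and h: "\<phi> b \<otimes>\<^bsub>T\<^esub> v = \<phi> h"
    using mem[of a u] mem[of b u] mem[of a v] mem[of b v] uv(1,2) by auto
  have inj: "x = y" if "\<phi> x = \<phi> y" "x \<in> carrier R" "y \<in> carrier R" for x y
    using that inj_on_to_total unfolding \<phi>_def by (simp add: inj_on_def)
  have "\<phi> \<one> = \<phi> (e \<oplus> h)" using uv(3) efgh by (simp add: e h ha)
  hence "\<one> = e \<oplus> h" using inj efgh by simp
  hence h_eq: "h = \<one> \<ominus> e" using efgh by algebra
  have "\<phi> (a \<otimes> f) = \<phi> (b \<otimes> e)"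
    using a b efgh uv by (simp add: hm hc Jc T.m_ac flip: e f)
  hence 1: "a \<otimes> f = b \<otimes> e" using inj a b efgh by simp
  have "\<phi> (b \<otimes> g) = \<phi> (a \<otimes> h)"
    using a b efgh uv by (simp add: hm hc Jc T.m_ac flip: g h)
  hence 2: "b \<otimes> g = a \<otimes> h" using inj a b efgh by simp
  show ?thesis using that[of e f g] efgh 1 2 unfolding h_eq by simp
qed

section \<open>Primes with nonzero intersection\<close>

lemma (in ideal) Quot_cases:
  assumes "X \<in> carrier (R Quot I)"
  obtains x where "x \<in> carrier R" "X = I +> x"
  using assms by (auto simp: FactRing_simps)

lemma (in ideal) rcos_eq_zero_iff:
  assumes "y \<in> carrier R"
  shows "I +> y = \<zero>\<^bsub>R Quot I\<^esub> \<longleftrightarrow> y \<in> I"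
proof -
  have zero: "\<zero>\<^bsub>R Quot I\<^esub> = I" by (simp add: FactRing_def)
  show ?thesis
    unfolding zero using rcos_const_imp_mem[OF assms] a_rcos_const by blast
qed

text \<open>
  A prime that contains \<open>x y\<close> but not \<open>x\<close> contains \<open>y\<close>; apply this to \<open>p\<close> and to \<open>q\<close>.
\<close>

lemma (in cring) regular_modulo_inter_primes:
  assumes p: "primeideal p R" and q: "primeideal q R"
    and x: "x \<in> carrier R" "x \<notin> p" "x \<notin> q"
  shows "(p \<inter> q) +> x \<in> regular_elements (R Quot (p \<inter> q))"
proof -
  interpret p: primeideal p R by (rule p)
  interpret q: primeideal q R by (rule q)
  interpret I: ideal "p \<inter> q" R by (intro i_intersect p.ideal_axioms q.ideal_axioms)
  interpret h: ring_hom_ring R "R Quot (p \<inter> q)" "(+>) (p \<inter> q)"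
    by (rule I.rcos_ring_hom_ring)
  show ?thesis
    unfolding regular_elements_def
  proof (intro CollectI conjI ballI impI)
    fix Y assume Y: "Y \<in> carrier (R Quot (p \<inter> q))"
      and eq: "((p \<inter> q) +> x) \<otimes>\<^bsub>R Quot (p \<inter> q)\<^esub> Y = \<zero>\<^bsub>R Quot (p \<inter> q)\<^esub>"
    obtain y where y: "y \<in> carrier R" "Y = (p \<inter> q) +> y"
      using I.Quot_cases[OF Y] by blast
    have "(p \<inter> q) +> (x \<otimes> y) = \<zero>\<^bsub>R Quot (p \<inter> q)\<^esub>"
      using eq h.hom_mult[OF x(1) y(1)] unfolding y(2) by simp
    hence "x \<otimes> y \<in> p \<inter> q" using I.rcos_eq_zero_iff x(1) y(1) by blast
    hence "y \<in> p \<inter> q" using p.I_prime q.I_prime x y(1) by blast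
    thus "Y = \<zero>\<^bsub>R Quot (p \<inter> q)\<^esub>" unfolding y(2) by (simp only: I.rcos_eq_zero_iff[OF y(1)])
  qed (rule h.hom_closed[OF x(1)])
qed

text \<open>
  If \<open>a \<in> p - q\<close> and \<open>b \<in> q - p\<close>, the sum \<open>a + b\<close> avoids both primes, so it makes \<open>(a, b)\<close> a regular
  ideal of the proper quotient \<open>R/(p \<inter> q)\<close>. Invertibility yields \<open>e, f, g\<close> with \<open>a f = b e\<close> and
  \<open>b g = a (1 - e)\<close> modulo \<open>p \<inter> q\<close>. The first equation forces \<open>b e \<in> p\<close>, hence \<open>e \<in> p\<close>; the second
  forces \<open>a (1 - e) \<in> q\<close>, hence \<open>1 - e \<in> q\<close>. So \<open>p + q\<close> contains \<open>1\<close> and lies in no proper ideal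
  \<open>M\<close>.
\<close>

lemma (in pre_pruefer_ring) primes_comparable_if_inter_nonzero:
  assumes p: "primeideal p R" and q: "primeideal q R"
    and M: "ideal M R" "M \<noteq> carrier R" "p \<subseteq> M" "q \<subseteq> M"
    and nz: "p \<inter> q \<noteq> {\<zero>}"
  shows "p \<subseteq> q \<or> q \<subseteq> p"
proof (rule ccontr)
  assume "\<not> (p \<subseteq> q \<or> q \<subseteq> p)"
  then obtain a b where ap: "a \<in> p" and aq: "a \<notin> q" and bq: "b \<in> q" and bp: "b \<notin> p"
    by blast
  interpret p: primeideal p R by (rule p)
  interpret q: primeideal q R by (rule q)
  interpret M: ideal M R by (rule M(1))
  define I where "I = p \<inter> q"
  interpret I: ideal I R
    unfolding I_def by (intro i_intersect p.ideal_axioms q.ideal_axioms)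
  have a: "a \<in> carrier R" and b: "b \<in> carrier R"
    using ap bq p.Icarr q.Icarr by auto
  have "I \<noteq> carrier R" unfolding I_def using aq a by blast
  then interpret Q: pruefer_ring "R Quot I"
    using proper_quotient_pruefer[OF I.ideal_axioms] nz unfolding I_def by blast
  interpret h: ring_hom_ring R "R Quot I" "(+>) I"
    by (rule I.rcos_ring_hom_ring)
  let ?K = "Idl\<^bsub>R Quot I\<^esub> {I +> a, I +> b}"
  have gens: "{I +> a, I +> b} \<subseteq> carrier (R Quot I)" using a b by simp
  have K: "ideal ?K (R Quot I)" by (rule Q.genideal_ideal[OF gens])
  have "a \<oplus> b \<notin> p"
  proof
    assume "a \<oplus> b \<in> p"
    hence "(a \<oplus> b) \<ominus> a \<in> p" using ap p.a_closed p.a_inv_closed by (simp add: a_minus_def)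
    moreover have "(a \<oplus> b) \<ominus> a = b" using a b by algebra
    ultimately show False using bp by simp
  qed
  moreover have "a \<oplus> b \<notin> q"
  proof
    assume "a \<oplus> b \<in> q"
    hence "(a \<oplus> b) \<ominus> b \<in> q" using bq q.a_closed q.a_inv_closed by (simp add: a_minus_def)
    moreover have "(a \<oplus> b) \<ominus> b = a" using a b by algebra
    ultimately show False using aq by simp
  qed
  ultimately have "I +> (a \<oplus> b) \<in> regular_elements (R Quot I)"
    unfolding I_def using a b by (intro regular_modulo_inter_primes[OF p q]) auto
  moreover have "I +> (a \<oplus> b) \<in> ?K"
    using Q.genideal_self[OF gens] a b additive_subgroup.a_closed[OF ideal.axioms(1)[OF K]]
    by simp
  ultimately have "regular_ideal (R Quot I) ?K"
    using K unfolding regular_ideal_def by blast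
  moreover have "fin_gen_ideal (R Quot I) ?K"
    unfolding fin_gen_ideal_def using gens by blast
  ultimately have "invertible_ideal (R Quot I) ?K"
    using Q.fin_gen_regular_invertible K by blast
  then obtain E F G where EFG: "E \<in> carrier (R Quot I)" "F \<in> carrier (R Quot I)"
      "G \<in> carrier (R Quot I)"
    and eqs: "(I +> a) \<otimes>\<^bsub>R Quot I\<^esub> F = (I +> b) \<otimes>\<^bsub>R Quot I\<^esub> E"
      "(I +> b) \<otimes>\<^bsub>R Quot I\<^esub> G = (I +> a) \<otimes>\<^bsub>R Quot I\<^esub> (\<one>\<^bsub>R Quot I\<^esub> \<ominus>\<^bsub>R Quot I\<^esub> E)"
    using Q.invertible_pair_locally_principal gens by blast
  obtain e f g where efg: "e \<in> carrier R" "f \<in> carrier R" "g \<in> carrier R"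
    and E: "E = I +> e" and F: "F = I +> f" and G: "G = I +> g"
    using I.Quot_cases EFG by metis
  have sub: "I +> (\<one> \<ominus> e) = \<one>\<^bsub>R Quot I\<^esub> \<ominus>\<^bsub>R Quot I\<^esub> E"
    unfolding E using efg by (simp add: a_minus_def)
  have "I +> (a \<otimes> f) = I +> (b \<otimes> e)" "I +> (b \<otimes> g) = I +> (a \<otimes> (\<one> \<ominus> e))"
    using eqs a b efg by (simp_all add: E F G sub)
  hence mem: "a \<otimes> f \<ominus> b \<otimes> e \<in> I" "b \<otimes> g \<ominus> a \<otimes> (\<one> \<ominus> e) \<in> I"
    using quotient_eq_iff_same_a_r_cos[OF I.ideal_axioms] a b efg by simp_all
  have minus_memD: "y \<in> J" if "ideal J R" "x \<in> J" "y \<in> carrier R" "x \<ominus> y \<in> J" for J x y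
  proof -
    interpret J: ideal J R by (rule that(1))
    have "x \<in> carrier R" using that(2) J.Icarr by blast
    hence "x \<ominus> (x \<ominus> y) = y" using that(3) by algebra
    moreover have "x \<ominus> (x \<ominus> y) \<in> J"
      using that(2,4) J.a_closed J.a_inv_closed by (simp add: a_minus_def)
    ultimately show ?thesis by simp
  qed
  have "b \<otimes> e \<in> p"
    using minus_memD[OF p.ideal_axioms, of "a \<otimes> f" "b \<otimes> e"] mem(1) ap a b efg p.I_r_closed
    unfolding I_def by simp
  hence "e \<in> M" using p.I_prime[OF b efg(1)] bp M(3) by blast
  moreover have "a \<otimes> (\<one> \<ominus> e) \<in> q"
    using minus_memD[OF q.ideal_axioms, of "b \<otimes> g" "a \<otimes> (\<one> \<ominus> e)"] mem(2) bq a b efg q.I_r_closed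
    unfolding I_def by simp
  hence "\<one> \<ominus> e \<in> M" using q.I_prime[OF a, of "\<one> \<ominus> e"] efg aq M(4) by auto
  ultimately have "(\<one> \<ominus> e) \<oplus> e \<in> M" by (intro M.a_closed)
  moreover have "(\<one> \<ominus> e) \<oplus> e = \<one>" using efg by algebra
  ultimately show False using M.one_imp_carrier M(2) by simp
qed

section \<open>Primes of a localization\<close>

context mult_subset
begin

lemma loc_map_ring_hom_ring: "ring_hom_ring R (localization R S) (loc_map R S)"
  using ring_axioms cring.axioms(1)[OF localization_cring] loc_map_hom by (rule ring_hom_ringI2)

text \<open>
  The fractions \<open>a/s\<close> and \<open>a/1\<close> differ by the unit \<open>1/s\<close>, so ideals of the localization cannot
  tell them apart; in particular they are determined by their contractions to \<open>R\<close>.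
\<close>

lemma frac_of_mem_ideal_iff:
  assumes P: "ideal P (localization R S)" and "a \<in> carrier R" "s \<in> S"
  shows "frac_of R S a s \<in> P \<longleftrightarrow> loc_map R S a \<in> P"
proof
  interpret P: ideal P "localization R S" by (rule P)
  assume "frac_of R S a s \<in> P"
  hence "frac_of R S a s \<otimes>\<^bsub>localization R S\<^esub> frac_of R S s \<one> \<in> P"
    using assms frac_of_closed by (intro P.I_r_closed) auto
  moreover have "frac_of R S a s \<otimes>\<^bsub>localization R S\<^esub> frac_of R S s \<one> = loc_map R S a"
    unfolding loc_map_def using assms
    by (simp add: localization_mult) (rule frac_of_eqI', simp_all)
  ultimately show "loc_map R S a \<in> P" by simp
next
  interpret P: ideal P "localization R S" by (rule P)
  assume "loc_map R S a \<in> P"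
  hence "loc_map R S a \<otimes>\<^bsub>localization R S\<^esub> frac_of R S \<one> s \<in> P"
    using assms frac_of_closed by (intro P.I_r_closed) auto
  thus "frac_of R S a s \<in> P"
    unfolding loc_map_def using assms by (simp add: localization_mult)
qed

lemma ideal_subset_if_contraction_subset:
  assumes P: "ideal P (localization R S)" and Q: "ideal Q (localization R S)"
    and sub: "{a \<in> carrier R. loc_map R S a \<in> P} \<subseteq> {a \<in> carrier R. loc_map R S a \<in> Q}"
  shows "P \<subseteq> Q"
proof
  fix X assume X: "X \<in> P"
  then obtain a s where "a \<in> carrier R" "s \<in> S" "X = frac_of R S a s"
    using localization_cases ideal.Icarr[OF P] by metis
  thus "X \<in> Q" using X sub frac_of_mem_ideal_iff[OF P] frac_of_mem_ideal_iff[OF Q] by blast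
qed

lemma contraction_disjoint:
  assumes P: "primeideal P (localization R S)" and s: "s \<in> S"
  shows "loc_map R S s \<notin> P"
proof
  interpret P: primeideal P "localization R S" by (rule P)
  assume "loc_map R S s \<in> P"
  hence "frac_of R S s s \<in> P" using frac_of_mem_ideal_iff[OF P.ideal_axioms] s by simp
  moreover have "frac_of R S s s = \<one>\<^bsub>localization R S\<^esub>"
    unfolding localization_one using s by (simp add: frac_of_eqI')
  ultimately show False using P.one_imp_carrier P.I_notcarr by simp
qed

text \<open>
  A regular element of \<open>P\<close> and a nonzero element of \<open>Q\<close> have a nonzero product, whose numerator
  lies in both contractions.
\<close>

lemma contractions_inter_nonzero:
  assumes P: "ideal P (localization R S)" and Q: "ideal Q (localization R S)"
    and reg: "regular_ideal (localization R S) P" and nz: "\<not> Q \<subseteq> {\<zero>\<^bsub>localization R S\<^esub>}"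
  shows "{a \<in> carrier R. loc_map R S a \<in> P} \<inter> {a \<in> carrier R. loc_map R S a \<in> Q} \<noteq> {\<zero>}"
proof -
  let ?L = "localization R S"
  interpret L: cring ?L by (rule localization_cring)
  interpret P: ideal P ?L by (rule P)
  interpret Q: ideal Q ?L by (rule Q)
  obtain X where X: "X \<in> P" "X \<in> regular_elements ?L"
    using reg unfolding regular_ideal_def by blast
  obtain Y where Y: "Y \<in> Q" "Y \<noteq> \<zero>\<^bsub>?L\<^esub>" using nz by blast
  have c: "X \<in> carrier ?L" "Y \<in> carrier ?L" using X Y P.Icarr Q.Icarr by auto
  have XY: "X \<otimes>\<^bsub>?L\<^esub> Y \<noteq> \<zero>\<^bsub>?L\<^esub>" using X(2) Y(2) c unfolding regular_elements_def by blast
  obtain c s where cs: "c \<in> carrier R" "s \<in> S" "X \<otimes>\<^bsub>?L\<^esub> Y = frac_of R S c s"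
    using localization_cases L.m_closed c by metis
  have "frac_of R S c s \<in> P" "frac_of R S c s \<in> Q"
    using X Y c P.I_r_closed Q.I_l_closed by (simp_all flip: cs(3))
  hence "loc_map R S c \<in> P" "loc_map R S c \<in> Q"
    using frac_of_mem_ideal_iff cs P Q by blast+
  moreover have "c \<noteq> \<zero>"
  proof
    assume "c = \<zero>"
    hence "frac_of R S c s = \<zero>\<^bsub>?L\<^esub>"
      unfolding localization_zero using cs by (intro frac_of_eqI') auto
    thus False using XY cs(3) by simp
  qed
  ultimately show ?thesis using cs(1) by blast
qed

end

theorem theorem4p7:
  fixes A :: "('a, 'b) ring_scheme" and M :: "'a set"
  assumes "pre_pruefer_ring A"
    and "maximalideal M A"
  shows "regular_total_order_property (localization_at A M) (Spec (localization_at A M))"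
proof -
  interpret A: pre_pruefer_ring A by (rule assms(1))
  interpret M: maximalideal M A by (rule assms(2))
  interpret M: primeideal M A by (rule A.maximalideal_prime[OF assms(2)])
  define S where "S = carrier A - M"
  interpret S: mult_subset A S unfolding S_def by (rule M.mult_subset_compl)
  let ?L = "localization A S"
  let ?c = "\<lambda>P. {a \<in> carrier A. loc_map A S a \<in> P}"
  have comparable: "P \<subseteq> Q \<or> Q \<subseteq> P"
    if P: "primeideal P ?L" and Q: "primeideal Q ?L" and reg: "regular_ideal ?L P" for P Q
  proof (cases "Q \<subseteq> {\<zero>\<^bsub>?L\<^esub>}")
    case True
    interpret P: primeideal P ?L by (rule P)
    show ?thesis using True P.zero_closed by auto
  next
    case False
    note PQ = primeideal.axioms(1)[OF P] primeideal.axioms(1)[OF Q]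
    note contr = ring_hom_ring.primeideal_vimage[OF S.loc_map_ring_hom_ring A.is_cring]
    have "?c P \<subseteq> ?c Q \<or> ?c Q \<subseteq> ?c P"
    proof (rule A.primes_comparable_if_inter_nonzero[OF contr[OF P] contr[OF Q] M.is_ideal])
      show "M \<noteq> carrier A" using M.I_notcarr by simp
      show "?c P \<subseteq> M" "?c Q \<subseteq> M"
        using S.contraction_disjoint P Q unfolding S_def by blast+
      show "?c P \<inter> ?c Q \<noteq> {\<zero>\<^bsub>A\<^esub>}"
        by (rule S.contractions_inter_nonzero[OF PQ reg False])
    qed
    thus ?thesis using S.ideal_subset_if_contraction_subset PQ by blast
  qed
  show ?thesis
    unfolding regular_total_order_property_def Spec_def localization_at_def S_def[symmetric]
    using comparable by blast
qed

end
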